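(* Let $\mathcal X$ be an arbitrary set and $\mathcal Y$ a finite set of class labels. Let $\mathcal C=\{\nu_i:i\ge1\}$ consist of classification models, i.e. for each $\nu\in\mathcal C$, $x\in\mathcal X$ and $y\in\mathcal Y$ we have $\nu(y|x)\ge0$ and $\sum_{y\in\mathcal Y}\nu(y|x)=1$. Each model $\nu$ is associated with a prior weight $w_\nu>0$, and $\sum_{\nu\in\mathcal C} w_\nu=1$ holds. Let the MDL predictions $\varrho^{\mathrm{static}}$ (static), $\varrho$ (un-normalized dynamic) and $\bar\varrho$ (normalized dynamic) be defined as in the context. Assume that $\mu\in\mathcal C$, where $\mu$ is the true distribution. Then for each $x_{<\infty}=(x_1,x_2,\ldots)\in\mathcal X^\infty$, $$\sum_{t=1}^\infty\mathbf E\sum_{y\in\mathcal Y}\Big(\sqrt{\mu(y|x_t)}-\sqrt{\varrho^{\mathrm{static}}(y|x_{1:t},y_{<t})}\Big)^2\le 21\,w_\mu^{-1},$$ $$\sum_{t=1}^\infty\mathbf E\sum_{y\in\mathcal Y}\Big(\mu(y|x_t)-\varrho^{\mathrm{static}}(y|x_{1:t},y_{<t})\Big)^2\le 21\,w_\mu^{-1}$$ holds. Similar assertions are satisfied for the normalized and the un-normalized dynamic MDL predictor. In particular, the predictive probabilities of all three MDL predictors converge to the true probabilities almost surely.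
   Context: Notation: $x_{1:n}=(x_1,\ldots,x_n)$, $x_{<n}=x_{1:n-1}$, similarly for $y$. Each $\nu\in\mathcal C$ induces a probability on $\mathcal Y^n$ by $\nu(y_{1:n}|x_{1:n})=\prod_{t=1}^n\nu(y_t|x_t)$ (equal to $1$ for $n=0$). The labels $y_t$ are sampled from the true distribution $\mu(\cdot|x_t)$; $\mathbf E$ and "almost surely" refer to $\mu$. MDL estimator: $\nu^*_{(x_{1:n},y_{1:n})}=\arg\max_{\nu\in\mathcal C}\{w_\nu\,\nu(y_{1:n}|x_{1:n})\}$, and $\varrho(y_{1:n}|x_{1:n})=\max_{\nu\in\mathcal C}\{w_\nu\,\nu(y_{1:n}|x_{1:n})\}$; for $n=0$, $\varrho(\emptyset)=\max_\nu w_\nu$. Predictors: - static MDL: $\varrho^{\mathrm{static}}(y_n|x_{1:n},y_{<n})=\nu^*_{(x_{<n},y_{<n})}(y_n|x_n)$; - (un-normalized) dynamic MDL: $\varrho(y_n|x_{1:n},y_{<n})=\varrho(y_{1:n}|x_{1:n})/\varrho(y_{<n}|x_{<n})$; - normalized dynamic MDL: $\bar\varrho(y_n|x_{1:n},y_{<n})=\varrho(y_{1:n}|x_{1:n})\big/\sum_{y_n'\in\mathcal Y}\varrho(y_{<n}y_n'|x_{1:n})$. The fractions are well defined except on a set of $\mu$-measure zero. *)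

theory Defs
  imports "HOL-Probability.Probability"
begin

type_synonym ('x, 'y) model = "'x \<Rightarrow> 'y \<Rightarrow> real"

type_synonym ('x, 'y) predictor = "'x list \<Rightarrow> 'y list \<Rightarrow> 'x \<Rightarrow> 'y \<Rightarrow> real"
  (* P xs ys x y: probability assigned to label y for the input x after the history (xs, ys) *)

definition classification_model :: "('x, 'y::finite) model \<Rightarrow> bool" where
  "classification_model \<nu> \<longleftrightarrow>
     (\<forall>x y. 0 \<le> \<nu> x y) \<and> (\<forall>x. (\<Sum>y\<in>UNIV. \<nu> x y) = 1)"

definition likelihood :: "('x, 'y) model \<Rightarrow> 'x list \<Rightarrow> 'y list \<Rightarrow> real" where
  "likelihood \<nu> xs ys = prod_list (map2 \<nu> xs ys)"

(* The supremum is a maximum, see mdl_value_attained below. *)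
definition mdl_value ::
    "('x, 'y) model set \<Rightarrow> (('x, 'y) model \<Rightarrow> real) \<Rightarrow> 'x list \<Rightarrow> 'y list \<Rightarrow> real" where
  "mdl_value C w xs ys = (SUP \<nu>\<in>C. w \<nu> * likelihood \<nu> xs ys)"

(* The maximizer need not be unique: nu_star is any selection of maximizers,
   with an arbitrary tie-breaking rule that may depend on the history. *)
definition mdl_estimator ::
    "('x, 'y) model set \<Rightarrow> (('x, 'y) model \<Rightarrow> real) \<Rightarrow>
     ('x list \<Rightarrow> 'y list \<Rightarrow> ('x, 'y) model) \<Rightarrow> bool" where
  "mdl_estimator C w \<nu>_star \<longleftrightarrow>
     (\<forall>xs ys. length xs = length ys \<longrightarrow>
        is_arg_max (\<lambda>\<nu>. w \<nu> * likelihood \<nu> xs ys) (\<lambda>\<nu>. \<nu> \<in> C) (\<nu>_star xs ys))"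

definition static_mdl ::
    "('x list \<Rightarrow> 'y list \<Rightarrow> ('x, 'y) model) \<Rightarrow> ('x, 'y) predictor" where
  "static_mdl \<nu>_star xs ys x y = \<nu>_star xs ys x y"

(* In both dynamic predictors a zero denominator yields the value 0; this only
   happens on histories of probability zero under every model in C. *)
definition dynamic_mdl ::
    "('x, 'y) model set \<Rightarrow> (('x, 'y) model \<Rightarrow> real) \<Rightarrow> ('x, 'y) predictor" where
  "dynamic_mdl C w xs ys x y =
     mdl_value C w (xs @ [x]) (ys @ [y]) / mdl_value C w xs ys"

definition normalized_dynamic_mdl ::
    "('x, 'y::finite) model set \<Rightarrow> (('x, 'y) model \<Rightarrow> real) \<Rightarrow> ('x, 'y) predictor" where
  "normalized_dynamic_mdl C w xs ys x y =
     mdl_value C w (xs @ [x]) (ys @ [y]) /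
     (\<Sum>y'\<in>UNIV. mdl_value C w (xs @ [x]) (ys @ [y']))"

(* Law of the infinite label sequence given the inputs. Sequences are indexed
   from 0, so x t and \<omega> t are the (t+1)-st input and label. *)
definition label_measure :: "('x, 'y::finite) model \<Rightarrow> (nat \<Rightarrow> 'x) \<Rightarrow> (nat \<Rightarrow> 'y) measure" where
  "label_measure \<mu> x =
     (\<Pi>\<^sub>M t\<in>UNIV. point_measure UNIV (\<lambda>y. ennreal (\<mu> (x t) y)))"

definition hellinger_distance :: "('y::finite \<Rightarrow> real) \<Rightarrow> ('y \<Rightarrow> real) \<Rightarrow> real" where
  "hellinger_distance p q = (\<Sum>y\<in>UNIV. (sqrt (p y) - sqrt (q y))\<^sup>2)"

definition quadratic_distance :: "('y::finite \<Rightarrow> real) \<Rightarrow> ('y \<Rightarrow> real) \<Rightarrow> real" where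
  "quadratic_distance p q = (\<Sum>y\<in>UNIV. (p y - q y)\<^sup>2)"

definition prediction_at ::
    "('x, 'y) predictor \<Rightarrow> (nat \<Rightarrow> 'x) \<Rightarrow> (nat \<Rightarrow> 'y) \<Rightarrow> nat \<Rightarrow> 'y \<Rightarrow> real" where
  "prediction_at P x \<omega> t = P (map x [0..<t]) (map \<omega> [0..<t]) (x t)"

(* Values in [0, \<infinity>], so that a finite upper bound includes convergence of the series. *)
definition cumulative_expected ::
    "(('y::finite \<Rightarrow> real) \<Rightarrow> ('y \<Rightarrow> real) \<Rightarrow> real) \<Rightarrow>
     ('x, 'y) model \<Rightarrow> ('x, 'y) predictor \<Rightarrow> (nat \<Rightarrow> 'x) \<Rightarrow> ennreal" where
  "cumulative_expected D \<mu> P x =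
     (\<Sum>t. \<integral>\<^sup>+ \<omega>. ennreal (D (\<mu> (x t)) (prediction_at P x \<omega> t)) \<partial>label_measure \<mu> x)"

(* The true probabilities vary with t, so convergence means that the difference vanishes. *)
definition converges_almost_surely ::
    "('x, 'y::finite) model \<Rightarrow> ('x, 'y) predictor \<Rightarrow> (nat \<Rightarrow> 'x) \<Rightarrow> bool" where
  "converges_almost_surely \<mu> P x \<longleftrightarrow>
     (AE \<omega> in label_measure \<mu> x.
        \<forall>y. (\<lambda>t. prediction_at P x \<omega> t y - \<mu> (x t) y) \<longlonglongrightarrow> 0)"

lemma prob_space_label_measure:
  assumes "classification_model \<mu>"
  shows "prob_space (label_measure \<mu> x)"
  unfolding label_measure_def using assms
  by (intro prob_space_PiM prob_space_point_measure)
     (auto simp: classification_model_def sum_ennreal)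

lemma likelihood_bounds:
  assumes "classification_model \<nu>"
  shows "0 \<le> likelihood \<nu> xs ys" "likelihood \<nu> xs ys \<le> 1"
proof -
  have nn: "0 \<le> \<nu> x y" for x y
    using assms by (auto simp: classification_model_def)
  have le: "\<nu> x y \<le> 1" for x y
  proof -
    have "\<nu> x y \<le> (\<Sum>y\<in>UNIV. \<nu> x y)"
      by (rule member_le_sum) (auto simp: nn)
    then show ?thesis using assms by (simp add: classification_model_def)
  qed
  have "0 \<le> likelihood \<nu> xs ys \<and> likelihood \<nu> xs ys \<le> 1"
    unfolding likelihood_def
    by (induction xs ys rule: list_induct2') (auto simp: nn le intro: mult_le_one)
  then show "0 \<le> likelihood \<nu> xs ys" "likelihood \<nu> xs ys \<le> 1" by auto
qed

lemma is_arg_max_exists: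
  assumes models: "\<forall>\<nu>\<in>C. classification_model \<nu>"
    and pos: "\<forall>\<nu>\<in>C. 0 < w \<nu>"
    and sum: "(w has_sum 1) C"
    and mem: "\<mu> \<in> C"
  shows "\<exists>\<nu>. is_arg_max (\<lambda>\<nu>. w \<nu> * likelihood \<nu> xs ys) (\<lambda>\<nu>. \<nu> \<in> C) \<nu>"
proof -
  define f where "f = (\<lambda>\<nu>. w \<nu> * likelihood \<nu> xs ys)"
  have f0: "0 \<le> f \<nu>" and fw: "f \<nu> \<le> w \<nu>" if "\<nu> \<in> C" for \<nu>
    using that models pos likelihood_bounds[of \<nu> xs ys]
    by (auto simp: f_def mult_left_le less_imp_le)
  show ?thesis
  proof (cases "\<forall>\<nu>\<in>C. f \<nu> = 0")
    case True
    then have "is_arg_max f (\<lambda>\<nu>. \<nu> \<in> C) \<mu>" using mem by (simp add: is_arg_max_def)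
    then show ?thesis unfolding f_def by blast
  next
    case False
    then obtain \<nu>0 where \<nu>0: "\<nu>0 \<in> C" "f \<nu>0 > 0" using f0 by force
    define B where "B = {\<nu>\<in>C. f \<nu>0 \<le> f \<nu>}"
    have "finite B"
    proof (rule ccontr)
      assume "infinite B"
      then obtain F where F: "F \<subseteq> B" "finite F" "card F = nat \<lceil>1 / f \<nu>0\<rceil> + 1"
        using infinite_arbitrarily_large by blast
      have "real (card F) * f \<nu>0 \<le> sum w F"
        using F(1) fw by (intro sum_bounded_below) (force simp: B_def)
      also have "\<dots> \<le> 1"
      proof (rule has_sum_mono2[OF has_sum_finite sum])
        show "finite F" "F \<subseteq> C" using F by (auto simp: B_def)
        show "0 \<le> w \<nu>" if "\<nu> \<in> C - F" for \<nu> using that pos by (auto intro: less_imp_le)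
      qed
      finally have "real (card F) \<le> 1 / f \<nu>0" using \<nu>0 by (simp add: field_simps)
      moreover have "1 / f \<nu>0 < real (card F)" using F(3) by linarith
      ultimately show False by simp
    qed
    moreover have "\<nu>0 \<in> B" using \<nu>0 by (auto simp: B_def)
    ultimately obtain m where m: "m \<in> B" "\<And>\<nu>. \<nu> \<in> B \<Longrightarrow> f \<nu> \<le> f m"
      using finite_imageI[of B f] Max_in[of "f ` B"] Max_ge[of "f ` B"]
      by (metis (no_types, lifting) empty_iff image_iff imageI)
    have "f \<nu> \<le> f m" if "\<nu> \<in> C" for \<nu>
      using m that \<open>\<nu>0 \<in> B\<close> by (cases "\<nu> \<in> B") (force simp: B_def)+
    then show ?thesis using m
      by (auto simp: is_arg_max_def f_def B_def not_less intro!: exI[of _ m])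
  qed
qed

lemma mdl_value_attained:
  assumes "is_arg_max (\<lambda>\<nu>. w \<nu> * likelihood \<nu> xs ys) (\<lambda>\<nu>. \<nu> \<in> C) \<nu>"
  shows "mdl_value C w xs ys = w \<nu> * likelihood \<nu> xs ys"
  unfolding mdl_value_def using assms
  by (intro cSup_eq_maximum) (auto simp: is_arg_max_linorder)

lemma mdl_estimator_exists:
  assumes "\<forall>\<nu>\<in>C. classification_model \<nu>" "\<forall>\<nu>\<in>C. 0 < w \<nu>" "(w has_sum 1) C" "\<mu> \<in> C"
  shows "\<exists>\<nu>_star. mdl_estimator C w \<nu>_star"
  unfolding mdl_estimator_def using is_arg_max_exists[OF assms] by metis

end

theory Submission
  imports Defs
begin

text \<open>
  Let \<open>M\<close> be the likelihood of a label history under \<open>\<mu>\<close>, \<open>V\<close> the maximal weighted likelihood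
  and \<open>W = 1 / w \<mu>\<close>, so that \<open>M \<le> W * V\<close>. Let \<open>q\<close> be the un-normalized dynamic prediction and
  \<open>Q \<ge> 1\<close> its total mass. The squared Hellinger distance is at most the generalized
  Kullback-Leibler divergence \<open>\<Sum>p ln (p / q) - p + q\<close>. Summed over histories, the logarithmic
  part telescopes to at most \<open>ln W \<le> W\<close>, and \<open>M * (Q - 1)\<close> is at most \<open>W\<close> times the
  growth of the total mass of \<open>V\<close>, which never exceeds \<open>1\<close>. Hence the cumulative expected
  distance \<open>h\<close> of \<open>q\<close> to \<open>\<mu>\<close> is at most \<open>2 W\<close> and that of \<open>Q - 1\<close> at most \<open>W\<close>. Normalizing \<open>q\<close>
  only decreases \<open>h\<close>, and the static prediction lies below \<open>q\<close> with total gap \<open>Q - 1\<close>; so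
  all the distances in question are at most \<open>8 h + 2 (Q - 1)\<close>, which sums to \<open>18 W\<close>.
\<close>

section \<open>Inequalities between distances\<close>

text \<open>This is \<open>ln z \<le> z - 1\<close> at \<open>z = sqrt (q / p)\<close>. The terms
  \<open>- p + q\<close> make it hold pointwise, so it also serves predictions of total mass above
  1.\<close>

lemma hellinger_le_divergence:
  fixes p q :: real
  assumes "0 \<le> p" "0 \<le> q" "0 < p \<Longrightarrow> 0 < q"
  shows "(sqrt p - sqrt q)\<^sup>2 \<le> p * ln (p / q) - p + q"
proof (cases "p = 0")
  case False
  then have pq: "0 < p" "0 < q" using assms by auto
  have "ln (q / p) = 2 * ln (sqrt (q / p))"
    using pq by (simp add: ln_sqrt)
  also have "\<dots> \<le> 2 * (sqrt (q / p) - 1)"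
    using pq by (intro mult_left_mono ln_le_minus_one) auto
  finally have "p * (2 - 2 * sqrt (q / p)) \<le> p * ln (p / q)"
    using pq by (intro mult_left_mono) (auto simp: ln_div)
  moreover have "p * sqrt (q / p) = sqrt p * sqrt q"
    using pq by (simp add: real_sqrt_divide field_simps flip: power2_eq_square)
  ultimately show ?thesis
    using pq by (simp add: power2_diff algebra_simps)
qed (use assms in auto)

lemma sqrt_diff_squared_le:
  fixes a b :: real
  assumes "0 \<le> a" "a \<le> b"
  shows "(sqrt b - sqrt a)\<^sup>2 \<le> b - a"
proof -
  have "a = sqrt a * sqrt a" using assms by simp
  also have "\<dots> \<le> sqrt a * sqrt b" using assms by (intro mult_left_mono) auto
  finally show ?thesis using assms by (simp add: power2_diff algebra_simps)
qed

text \<open>\<open>a - b\<close> factors through the square roots, whose sum is at most 2; hence the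
  4.\<close>

lemma diff_squared_le_hellinger:
  fixes a b :: real
  assumes "0 \<le> a" "a \<le> 1" "0 \<le> b" "b \<le> 1"
  shows "(a - b)\<^sup>2 \<le> 4 * (sqrt a - sqrt b)\<^sup>2"
proof -
  have "a - b = (sqrt a - sqrt b) * (sqrt a + sqrt b)"
    using assms by (simp add: algebra_simps)
  then have "(a - b)\<^sup>2 = (sqrt a - sqrt b)\<^sup>2 * (sqrt a + sqrt b)\<^sup>2"
    by (simp add: power_mult_distrib)
  also have "\<dots> \<le> (sqrt a - sqrt b)\<^sup>2 * 2\<^sup>2"
    using assms add_mono[of "sqrt a" 1 "sqrt b" 1] by (intro mult_left_mono power_mono) auto
  finally show ?thesis by simp
qed

text \<open>The slack is the square of \<open>a - 2 * b + c\<close>. Both distances inherit the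
  factor 2.\<close>

lemma square_diff_triangle:
  fixes a b c :: real
  shows "(a - c)\<^sup>2 \<le> 2 * (a - b)\<^sup>2 + 2 * (b - c)\<^sup>2"
proof -
  have "2 * (a - b)\<^sup>2 + 2 * (b - c)\<^sup>2 - (a - c)\<^sup>2 = (a - 2 * b + c)\<^sup>2"
    by (simp add: power2_eq_square algebra_simps)
  then show ?thesis by (smt (verit) zero_le_power2)
qed

lemma hellinger_distance_nonneg: "0 \<le> hellinger_distance p q"
  by (simp add: hellinger_distance_def sum_nonneg)

lemma quadratic_distance_nonneg: "0 \<le> quadratic_distance p q"
  by (simp add: quadratic_distance_def sum_nonneg)

lemma quadratic_distance_le_hellinger_distance:
  fixes p q :: "'y::finite \<Rightarrow> real"
  assumes "\<And>y. 0 \<le> p y" "\<And>y. p y \<le> 1" "\<And>y. 0 \<le> q y" "\<And>y. q y \<le> 1"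
  shows "quadratic_distance p q \<le> 4 * hellinger_distance p q"
  unfolding quadratic_distance_def hellinger_distance_def sum_distrib_left
  by (intro sum_mono diff_squared_le_hellinger assms)

lemma hellinger_distance_triangle:
  "hellinger_distance p r \<le> 2 * hellinger_distance p q + 2 * hellinger_distance q r"
  unfolding hellinger_distance_def sum_distrib_left sum.distrib[symmetric]
  by (intro sum_mono square_diff_triangle)

lemma quadratic_distance_triangle:
  "quadratic_distance p r \<le> 2 * quadratic_distance p q + 2 * quadratic_distance q r"
  unfolding quadratic_distance_def sum_distrib_left sum.distrib[symmetric]
  by (intro sum_mono square_diff_triangle)

lemma hellinger_distance_expand:
  fixes p q :: "'y::finite \<Rightarrow> real"
  assumes "\<And>y. 0 \<le> p y" "\<And>y. 0 \<le> q y"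
  shows "hellinger_distance p q =
    (\<Sum>y\<in>UNIV. p y) + (\<Sum>y\<in>UNIV. q y) - 2 * (\<Sum>y\<in>UNIV. sqrt (p y) * sqrt (q y))"
  using assms
  by (simp add: hellinger_distance_def power2_diff sum.distrib sum_subtractf
      sum_distrib_left mult.assoc)

text \<open>Writing \<open>Q\<close> for the mass of \<open>q\<close>, the two sides differ by at least \<open>(sqrt Q - 1)\<^sup>2\<close>,
  by the Cauchy-Schwarz inequality.\<close>

lemma hellinger_distance_normalize_le:
  fixes p q :: "'y::finite \<Rightarrow> real"
  assumes p: "\<And>y. 0 \<le> p y" "(\<Sum>y\<in>UNIV. p y) = 1"
    and q: "\<And>y. 0 \<le> q y" "1 \<le> (\<Sum>y\<in>UNIV. q y)"
  shows "hellinger_distance p (\<lambda>y. q y / (\<Sum>y\<in>UNIV. q y)) \<le> hellinger_distance p q"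
proof -
  define Q where "Q = (\<Sum>y\<in>UNIV. q y)"
  define B where "B = (\<Sum>y\<in>UNIV. sqrt (p y) * sqrt (q y))"
  define s where "s = sqrt Q"
  have s: "1 \<le> s" "Q = s\<^sup>2" using q(2) by (auto simp: s_def Q_def)
  have "B\<^sup>2 \<le> (\<Sum>y\<in>UNIV. (sqrt (p y))\<^sup>2) * (\<Sum>y\<in>UNIV. (sqrt (q y))\<^sup>2)"
    unfolding B_def by (rule Cauchy_Schwarz_ineq_sum)
  also have "\<dots> = s\<^sup>2" using p q s by (simp add: Q_def)
  finally have B: "B \<le> s" using s(1) by (auto intro: power2_le_imp_le[of B s])
  have "(\<Sum>y\<in>UNIV. sqrt (p y) * sqrt (q y / Q)) = B / s"
    by (simp add: B_def s_def real_sqrt_divide sum_divide_distrib)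
  moreover have "(\<Sum>y\<in>UNIV. q y / Q) = 1"
    using q(2) by (simp add: Q_def flip: sum_divide_distrib)
  ultimately have "hellinger_distance p (\<lambda>y. q y / Q) = 2 - 2 * (B / s)"
    using p q(1) s by (subst hellinger_distance_expand) auto
  moreover have "hellinger_distance p q = 1 + s\<^sup>2 - 2 * B"
    using p q(1) s(2) by (subst hellinger_distance_expand) (auto simp: B_def Q_def)
  moreover have "2 * (B * (1 - 1 / s)) \<le> 2 * (s * (1 - 1 / s))"
    using B s(1) by (intro mult_left_mono mult_right_mono) auto
  moreover have "s * (1 - 1 / s) = s - 1" using s(1) by (simp add: field_simps)
  moreover have "0 \<le> (s - 1)\<^sup>2" by simp
  ultimately show ?thesis
    unfolding Q_def[symmetric] by (simp add: power2_diff algebra_simps)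
qed

subsection \<open>Expectations over label histories\<close>

lemma finite_lists_length: "finite {ys :: 'y::finite list. length ys = n}"
  using finite_lists_length_eq[of "UNIV :: 'y set" n] by simp

lemma sum_lists_Suc:
  fixes f :: "'y::finite list \<Rightarrow> real"
  shows "(\<Sum>ys | length ys = Suc n. f ys) =
         (\<Sum>ys | length ys = n. \<Sum>y\<in>UNIV. f (ys @ [y]))"
proof -
  have "bij_betw (\<lambda>(ys, y). ys @ [y]) ({ys. length ys = n} \<times> UNIV) {ys :: 'y list. length ys = Suc n}"
  proof (rule bij_betwI')
    fix zs :: "'y list" assume "zs \<in> {ys. length ys = Suc n}"
    then show "\<exists>p\<in>{ys. length ys = n} \<times> UNIV. zs = (case p of (ys, y) \<Rightarrow> ys @ [y])"
      by (intro bexI[of _ "(butlast zs, last zs)"])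
         (auto intro: append_butlast_last_id[symmetric])
  qed auto
  from sum.reindex_bij_betw[OF this, of f] show ?thesis
    by (simp add: sum.cartesian_product case_prod_unfold)
qed

lemma likelihood_Nil [simp]: "likelihood \<kappa> [] [] = 1"
  by (simp add: likelihood_def)

lemma likelihood_snoc [simp]:
  "length xs = length ys \<Longrightarrow> likelihood \<kappa> (xs @ [a]) (ys @ [y]) = likelihood \<kappa> xs ys * \<kappa> a y"
  by (simp add: likelihood_def)

lemma likelihood_conv_prod:
  "length ys = n \<Longrightarrow> likelihood \<kappa> (map x [0..<n]) ys = (\<Prod>i<n. \<kappa> (x i) (ys ! i))"
proof (induction ys arbitrary: n rule: rev_induct)
  case (snoc y ys)
  then obtain m where "n = Suc m" "length ys = m" by (cases n) auto
  then show ?case using snoc.IH[of m] by (simp add: nth_append)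
qed simp

text \<open>Induction that sums out the last label.\<close>

lemma sum_likelihood:
  fixes \<kappa> :: "('x, 'y::finite) model"
  assumes "classification_model \<kappa>"
  shows "(\<Sum>ys | length ys = n. likelihood \<kappa> (map x [0..<n]) ys) = 1"
proof (induction n)
  case (Suc n)
  have "(\<Sum>ys | length ys = Suc n. likelihood \<kappa> (map x [0..<Suc n]) ys) =
        (\<Sum>ys | length ys = n. \<Sum>y\<in>UNIV. likelihood \<kappa> (map x [0..<n]) ys * \<kappa> (x n) y)"
    unfolding sum_lists_Suc by (intro sum.cong) auto
  also have "\<dots> = (\<Sum>ys | length ys = n. likelihood \<kappa> (map x [0..<n]) ys)"
    using assms by (simp add: classification_model_def flip: sum_distrib_left)
  finally show ?case using Suc by simp
qed simp

text \<open>The sequences that extend a fixed history form a cylinder of the product measure, so the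
  measure factors into one-label probabilities.\<close>

lemma cylinder_label_measure:
  fixes \<mu> :: "('x, 'y::finite) model"
  assumes \<mu>: "classification_model \<mu>" and len: "length ys = n"
  shows "{\<omega>. map \<omega> [0..<n] = ys} \<in> sets (label_measure \<mu> x)" (is "?A \<in> _")
    and "emeasure (label_measure \<mu> x) {\<omega>. map \<omega> [0..<n] = ys} =
           ennreal (likelihood \<mu> (map x [0..<n]) ys)"
proof -
  define N where "N = (\<lambda>t. point_measure (UNIV :: 'y set) (\<lambda>y. ennreal (\<mu> (x t) y)))"
  have pos: "0 \<le> \<mu> a y" for a y using \<mu> by (auto simp: classification_model_def)
  have N: "prob_space (N t)" for t
    unfolding N_def using \<mu>
    by (intro prob_space_point_measure) (auto simp: classification_model_def sum_ennreal)
  interpret product_prob_space N UNIV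
    using N by (rule product_prob_spaceI)
  have space: "space (N t) = UNIV" for t by (simp add: N_def space_point_measure)
  have eq: "?A = prod_emb UNIV N {..<n} (\<Pi>\<^sub>E i\<in>{..<n}. {ys ! i})"
  proof -
    have "map \<omega> [0..<n] = ys \<longleftrightarrow> (\<forall>i<n. \<omega> i = ys ! i)" for \<omega>
      using len by (simp add: list_eq_iff_nth_eq)
    moreover have "prod_emb UNIV N {..<n} (\<Pi>\<^sub>E i\<in>{..<n}. {ys ! i}) = {\<omega>. \<forall>i<n. \<omega> i = ys ! i}"
      by (simp add: prod_emb_PiE space PiE_UNIV_domain) (auto simp: space Pi_iff split: if_splits)
    ultimately show ?thesis by simp
  qed
  have sets: "{y} \<in> sets (N t)" for y t by (simp add: N_def sets_point_measure)
  have lm: "label_measure \<mu> x = PiM UNIV N"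
    by (simp add: label_measure_def N_def)
  show "?A \<in> sets (label_measure \<mu> x)"
    unfolding lm eq using sets by (intro sets_PiM_I) auto
  have "emeasure (PiM UNIV N) ?A = (\<Prod>i<n. emeasure (N i) {ys ! i})"
    unfolding eq using sets by (intro emeasure_PiM_emb) auto
  also have "\<dots> = (\<Prod>i<n. ennreal (\<mu> (x i) (ys ! i)))"
    by (intro prod.cong) (auto simp: N_def emeasure_point_measure_finite)
  also have "\<dots> = ennreal (likelihood \<mu> (map x [0..<n]) ys)"
    using pos by (simp add: prod_ennreal likelihood_conv_prod[OF len])
  finally show "emeasure (label_measure \<mu> x) ?A = \<dots>" by (simp add: lm)
qed

text \<open>A function of the history is a finite combination of cylinder indicators; measurability
  and integral are read off from this form.\<close>

lemma history_indicator_sum: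
  fixes F :: "'y::finite list \<Rightarrow> ennreal"
  shows "F (map \<omega> [0..<n]) =
    (\<Sum>ys | length ys = n. F ys * indicator {\<omega>. map \<omega> [0..<n] = ys} \<omega>)"
proof -
  have "(\<Sum>ys | length ys = n. F ys * indicator {\<omega>. map \<omega> [0..<n] = ys} \<omega>) =
        (\<Sum>ys | length ys = n. if map \<omega> [0..<n] = ys then F ys else 0)"
    by (intro sum.cong) (auto simp: indicator_def)
  then show ?thesis by (simp add: sum.delta' finite_lists_length)
qed

lemma measurable_history:
  fixes \<mu> :: "('x, 'y::finite) model" and F :: "'y list \<Rightarrow> ennreal"
  assumes "classification_model \<mu>"
  shows "(\<lambda>\<omega>. F (map \<omega> [0..<n])) \<in> borel_measurable (label_measure \<mu> x)"
proof -
  have "(\<lambda>\<omega>. \<Sum>ys | length ys = n. F ys * indicator {\<omega>. map \<omega> [0..<n] = ys} \<omega>)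
    \<in> borel_measurable (label_measure \<mu> x)"
  proof (rule borel_measurable_sum)
    fix ys :: "'y list" assume "ys \<in> {ys. length ys = n}"
    then have [measurable]: "{\<omega>. map \<omega> [0..<n] = ys} \<in> sets (label_measure \<mu> x)"
      using cylinder_label_measure(1)[OF assms] by simp
    show "(\<lambda>\<omega>. F ys * indicator {\<omega>. map \<omega> [0..<n] = ys} \<omega>)
      \<in> borel_measurable (label_measure \<mu> x)"
      by measurable
  qed
  then show ?thesis by (subst history_indicator_sum)
qed

lemma nn_integral_history:
  fixes \<mu> :: "('x, 'y::finite) model" and F :: "'y list \<Rightarrow> real"
  assumes \<mu>: "classification_model \<mu>" and F: "\<And>ys. 0 \<le> F ys"
  shows "(\<integral>\<^sup>+ \<omega>. ennreal (F (map \<omega> [0..<n])) \<partial>label_measure \<mu> x) =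
    ennreal (\<Sum>ys | length ys = n. likelihood \<mu> (map x [0..<n]) ys * F ys)"
proof -
  have "(\<integral>\<^sup>+ \<omega>. ennreal (F (map \<omega> [0..<n])) \<partial>label_measure \<mu> x) =
    (\<integral>\<^sup>+ \<omega>. (\<Sum>ys | length ys = n. ennreal (F ys) * indicator {\<omega>. map \<omega> [0..<n] = ys} \<omega>)
       \<partial>label_measure \<mu> x)"
    by (subst history_indicator_sum[of "\<lambda>ys. ennreal (F ys)"]) simp
  also have "\<dots> = (\<Sum>ys | length ys = n. ennreal (F ys) * ennreal (likelihood \<mu> (map x [0..<n]) ys))"
    using cylinder_label_measure[OF \<mu>]
    by (subst nn_integral_sum) (auto intro!: sum.cong simp: nn_integral_cmult_indicator)
  also have "\<dots> = ennreal (\<Sum>ys | length ys = n. likelihood \<mu> (map x [0..<n]) ys * F ys)"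
    using F likelihood_bounds(1)[OF \<mu>]
    by (simp add: sum_ennreal mult.commute flip: ennreal_mult)
  finally show ?thesis .
qed

section \<open>Telescoping and almost sure convergence\<close>

text \<open>Summed over all histories of length \<open>t\<close>, \<open>step\<close> bounds the
  expected distance by the growth of the total potential, and the partial sums telescope. The totals
  of \<open>\<Psi>\<close> are unweighted, so the probability of a history has to be built into
  \<open>\<Psi>\<close>.\<close>

lemma cumulative_expected_le_potential:
  fixes \<mu> :: "('x, 'y::finite) model" and \<Psi> :: "nat \<Rightarrow> 'y list \<Rightarrow> real"
  assumes \<mu>: "classification_model \<mu>"
    and D: "\<And>p q. 0 \<le> D p q"
    and step: "\<And>t ys. length ys = t \<Longrightarrow>
      likelihood \<mu> (map x [0..<t]) ys * D (\<mu> (x t)) (P (map x [0..<t]) ys (x t))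
        \<le> (\<Sum>y\<in>UNIV. \<Psi> (Suc t) (ys @ [y])) - \<Psi> t ys"
    and bound: "\<And>n. (\<Sum>ys | length ys = n. \<Psi> n ys) - \<Psi> 0 [] \<le> B"
  shows "cumulative_expected D \<mu> P x \<le> ennreal B"
proof -
  define E where "E t = (\<Sum>ys | length ys = t.
    likelihood \<mu> (map x [0..<t]) ys * D (\<mu> (x t)) (P (map x [0..<t]) ys (x t)))" for t
  define A where "A n = (\<Sum>ys | length ys = n. \<Psi> n ys)" for n
  have E0: "0 \<le> E t" for t
    unfolding E_def using D likelihood_bounds(1)[OF \<mu>] by (intro sum_nonneg mult_nonneg_nonneg)
  have "E t \<le> A (Suc t) - A t" for t
    unfolding E_def A_def sum_lists_Suc sum_subtractf[symmetric]
    by (intro sum_mono step) auto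
  then have "(\<Sum>t<n. E t) \<le> (\<Sum>t<n. A (Suc t) - A t)" for n
    by (intro sum_mono)
  also have "(\<Sum>t<n. A (Suc t) - A t) \<le> B" for n
    unfolding sum_lessThan_telescope using bound[of n] by (simp add: A_def)
  finally have le: "(\<Sum>t<n. E t) \<le> B" for n .
  have "cumulative_expected D \<mu> P x = (\<Sum>t. ennreal (E t))"
    unfolding cumulative_expected_def prediction_at_def E_def
    by (subst nn_integral_history[OF \<mu>, of "\<lambda>ys. D (\<mu> (x _)) (P (map x [0..<_]) ys (x _))"])
       (auto simp: D)
  also have "\<dots> \<le> ennreal B"
    using le E0 by (intro suminf_le_const summableI) (auto simp: sum_ennreal intro: ennreal_leI)
  finally show ?thesis .
qed

text \<open>A nonnegative series with finite expectation is almost surely finite, so its terms tend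
  to 0; each term dominates the squared error at every label.\<close>

lemma converges_almost_surely_if_quadratic_finite:
  fixes \<mu> :: "('x, 'y::finite) model"
  assumes \<mu>: "classification_model \<mu>"
    and fin: "cumulative_expected quadratic_distance \<mu> P x < \<infinity>"
  shows "converges_almost_surely \<mu> P x"
proof -
  define f where "f t \<omega> = quadratic_distance (\<mu> (x t)) (prediction_at P x \<omega> t)" for t \<omega>
  have meas: "(\<lambda>\<omega>. ennreal (f t \<omega>)) \<in> borel_measurable (label_measure \<mu> x)" for t
    unfolding f_def prediction_at_def
    by (rule measurable_history[OF \<mu>, of "\<lambda>ys. ennreal (quadratic_distance _ (P _ ys _))"])
  have "(\<integral>\<^sup>+ \<omega>. (\<Sum>t. ennreal (f t \<omega>)) \<partial>label_measure \<mu> x) \<noteq> \<infinity>"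
    using fin meas by (simp add: nn_integral_suminf cumulative_expected_def f_def)
  then have "AE \<omega> in label_measure \<mu> x. (\<Sum>t. ennreal (f t \<omega>)) \<noteq> \<infinity>"
    using meas by (intro nn_integral_PInf_AE) auto
  then show ?thesis
    unfolding converges_almost_surely_def
  proof (rule AE_mp, intro AE_I2 impI allI)
    fix \<omega> y assume fin: "(\<Sum>t. ennreal (f t \<omega>)) \<noteq> \<infinity>"
    have f0: "0 \<le> f t \<omega>" for t by (simp add: f_def quadratic_distance_nonneg)
    have "summable (\<lambda>t. f t \<omega>)"
      using fin f0 by (intro summable_suminf_not_top) auto
    then have lim: "(\<lambda>t. f t \<omega>) \<longlonglongrightarrow> 0" by (rule summable_LIMSEQ_zero)
    have "norm ((prediction_at P x \<omega> t y - \<mu> (x t) y)\<^sup>2) \<le> f t \<omega>" for t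
      using member_le_sum[of y UNIV "\<lambda>y. (\<mu> (x t) y - prediction_at P x \<omega> t y)\<^sup>2"]
      by (simp add: f_def quadratic_distance_def power2_commute)
    then have "(\<lambda>t. (prediction_at P x \<omega> t y - \<mu> (x t) y)\<^sup>2) \<longlonglongrightarrow> 0"
      by (intro Lim_null_comparison[OF _ lim] always_eventually allI)
    then show "(\<lambda>t. prediction_at P x \<omega> t y - \<mu> (x t) y) \<longlonglongrightarrow> 0"
      by (auto dest: tendsto_real_sqrt simp: tendsto_rabs_zero_iff)
  qed
qed

subsection \<open>The MDL predictors\<close>

locale mdl_prediction =
  fixes C :: "('x, 'y::finite) model set"
    and w :: "('x, 'y) model \<Rightarrow> real"
    and \<mu> :: "('x, 'y) model"
    and \<nu>_star :: "'x list \<Rightarrow> 'y list \<Rightarrow> ('x, 'y) model"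
  assumes models: "\<kappa> \<in> C \<Longrightarrow> classification_model \<kappa>"
    and weight_pos: "\<kappa> \<in> C \<Longrightarrow> 0 < w \<kappa>"
    and weight_sum: "(w has_sum 1) C"
    and true_model: "\<mu> \<in> C"
    and estimator: "mdl_estimator C w \<nu>_star"
begin

abbreviation V where "V xs ys \<equiv> mdl_value C w xs ys"
abbreviation M where "M xs ys \<equiv> likelihood \<mu> xs ys"

lemma model_nonneg: "\<kappa> \<in> C \<Longrightarrow> 0 \<le> \<kappa> a y"
  and model_sum: "\<kappa> \<in> C \<Longrightarrow> (\<Sum>y\<in>UNIV. \<kappa> a y) = 1"
  using models by (auto simp: classification_model_def)

lemma model_le_1: "\<kappa> \<in> C \<Longrightarrow> \<kappa> a y \<le> 1"
  using member_le_sum[of y UNIV "\<kappa> a"] model_nonneg model_sum[of \<kappa> a] by simp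

lemma likelihood_nonneg: "\<kappa> \<in> C \<Longrightarrow> 0 \<le> likelihood \<kappa> xs ys"
  using likelihood_bounds(1) models by blast

lemma star_in:
  assumes "length xs = length ys"
  shows "\<nu>_star xs ys \<in> C"
  using assms estimator by (simp add: mdl_estimator_def is_arg_max_def)

lemma value_star:
  assumes "length xs = length ys"
  shows "V xs ys = w (\<nu>_star xs ys) * likelihood (\<nu>_star xs ys) xs ys"
  using assms estimator by (intro mdl_value_attained) (simp add: mdl_estimator_def)

lemma value_ge:
  assumes "length xs = length ys" "\<kappa> \<in> C"
  shows "w \<kappa> * likelihood \<kappa> xs ys \<le> V xs ys"
  using assms estimator by (simp add: value_star mdl_estimator_def is_arg_max_linorder)

lemma value_nonneg:
  assumes "length xs = length ys"
  shows "0 \<le> V xs ys"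
  using assms star_in[OF assms] weight_pos likelihood_nonneg
  by (simp add: value_star less_imp_le)

lemma value_pos:
  assumes "length xs = length ys" "0 < M xs ys"
  shows "0 < V xs ys"
proof -
  have "0 < w \<mu> * M xs ys" using assms weight_pos true_model by simp
  then show ?thesis using value_ge[OF assms(1) true_model] by linarith
qed

text \<open>The maximizer for the shorter history competes on the longer one.\<close>

lemma value_snoc_ge:
  assumes "length xs = length ys"
  shows "V xs ys * \<nu>_star xs ys a y \<le> V (xs @ [a]) (ys @ [y])"
  using value_ge[of "xs @ [a]" "ys @ [y]" "\<nu>_star xs ys"] assms star_in
  by (simp add: value_star mult.assoc)

text \<open>The maximizer for the longer history competes on the shorter one, where its likelihood
  lacks a factor of at most 1.\<close>

lemma value_snoc_le:
  assumes "length xs = length ys"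
  shows "V (xs @ [a]) (ys @ [y]) \<le> V xs ys"
proof -
  let ?\<kappa> = "\<nu>_star (xs @ [a]) (ys @ [y])"
  have \<kappa>: "?\<kappa> \<in> C" using assms by (intro star_in) simp
  have "V (xs @ [a]) (ys @ [y]) = (w ?\<kappa> * likelihood ?\<kappa> xs ys) * ?\<kappa> a y"
    using assms by (simp add: value_star mult.assoc)
  also have "\<dots> \<le> w ?\<kappa> * likelihood ?\<kappa> xs ys"
    using weight_pos[OF \<kappa>] likelihood_nonneg[OF \<kappa>]
      model_nonneg[OF \<kappa>] model_le_1[OF \<kappa>] by (intro mult_right_le_one_le) auto
  also have "\<dots> \<le> V xs ys" using assms \<kappa> by (rule value_ge)
  finally show ?thesis .
qed

text \<open>The distribution \<open>\<nu>_star xs ys a\<close> splits \<open>V xs ys\<close> into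
  parts that the extensions dominate. This is why the dynamic prediction has mass at least
  1.\<close>

lemma value_le_sum_snoc:
  assumes "length xs = length ys"
  shows "V xs ys \<le> (\<Sum>y\<in>UNIV. V (xs @ [a]) (ys @ [y]))"
proof -
  have "V xs ys = (\<Sum>y\<in>UNIV. V xs ys * \<nu>_star xs ys a y)"
    using model_sum[OF star_in[OF assms]] by (simp flip: sum_distrib_left)
  also have "\<dots> \<le> (\<Sum>y\<in>UNIV. V (xs @ [a]) (ys @ [y]))"
    using assms by (intro sum_mono value_snoc_ge)
  finally show ?thesis .
qed

lemma weight_sum_le_1:
  assumes "finite F" "F \<subseteq> C"
  shows "sum w F \<le> 1"
  using assms weight_pos
  by (intro has_sum_mono2[OF has_sum_finite weight_sum]) (auto intro: less_imp_le)

text \<open>Each maximum is at most a mixture of models. After swapping the sums, the likelihoods of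
  every model add up to 1 and only weights remain.\<close>

lemma sum_value_le_1: "(\<Sum>ys | length ys = n. V (map x [0..<n]) ys) \<le> 1"
proof -
  \<comment> \<open>Only models selected on some history of length \<open>n\<close> enter the
    mixture, which keeps it finite.\<close>
  define F where "F = \<nu>_star (map x [0..<n]) ` {ys. length ys = n}"
  have F: "finite F" "F \<subseteq> C"
    using star_in[of "map x [0..<n]"] by (auto simp: F_def finite_lists_length)
  have "(\<Sum>ys | length ys = n. V (map x [0..<n]) ys)
    \<le> (\<Sum>ys | length ys = n. \<Sum>\<kappa>\<in>F. w \<kappa> * likelihood \<kappa> (map x [0..<n]) ys)"
  proof (intro sum_mono)
    fix ys :: "'y list" assume ys: "ys \<in> {ys. length ys = n}"
    let ?\<kappa> = "\<nu>_star (map x [0..<n]) ys"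
    have "0 \<le> w \<kappa> * likelihood \<kappa> (map x [0..<n]) ys" if "\<kappa> \<in> F" for \<kappa>
      using that F weight_pos likelihood_nonneg
      by (intro mult_nonneg_nonneg) (auto intro: less_imp_le)
    then have "w ?\<kappa> * likelihood ?\<kappa> (map x [0..<n]) ys
      \<le> (\<Sum>\<kappa>\<in>F. w \<kappa> * likelihood \<kappa> (map x [0..<n]) ys)"
      using F(1) ys
      by (intro member_le_sum[of ?\<kappa> F "\<lambda>\<kappa>. w \<kappa> * likelihood \<kappa> (map x [0..<n]) ys"])
         (auto simp: F_def)
    then show "V (map x [0..<n]) ys \<le> (\<Sum>\<kappa>\<in>F. w \<kappa> * likelihood \<kappa> (map x [0..<n]) ys)"
      using ys by (simp add: value_star)
  qed
  also have "\<dots> = (\<Sum>\<kappa>\<in>F. w \<kappa> * (\<Sum>ys | length ys = n. likelihood \<kappa> (map x [0..<n]) ys))"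
    by (subst sum.swap) (simp add: sum_distrib_left)
  also have "\<dots> = sum w F"
    using F models by (intro sum.cong) (auto simp: sum_likelihood)
  also have "\<dots> \<le> 1" using F by (rule weight_sum_le_1)
  finally show ?thesis .
qed

section \<open>One-step comparison of the three predictors\<close>

definition excess_mass :: "'x list \<Rightarrow> 'y list \<Rightarrow> 'x \<Rightarrow> real" where
  "excess_mass xs ys a = (\<Sum>y\<in>UNIV. dynamic_mdl C w xs ys a y) - 1"

text \<open>The coefficients come from the quadratic distance of the static predictor: the triangle
  inequality through the dynamic one doubles both parts, and passing from quadratic to Hellinger
  distance costs 4 on the first.\<close>

definition loss_bound :: "'x list \<Rightarrow> 'y list \<Rightarrow> 'x \<Rightarrow> real" where
  "loss_bound xs ys a =
     8 * hellinger_distance (\<mu> a) (dynamic_mdl C w xs ys a) + 2 * excess_mass xs ys a"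

text \<open>Monotonicity facts about \<open>V\<close>, divided by \<open>V xs ys\<close>, which is
  positive because \<open>M xs ys\<close> is. The last one supplies the positivity condition of
  \<open>hellinger_le_divergence\<close>.\<close>

lemma dynamic_bounds:
  assumes "length xs = length ys" "0 < M xs ys"
  shows "0 \<le> dynamic_mdl C w xs ys a y" "dynamic_mdl C w xs ys a y \<le> 1"
    and "\<nu>_star xs ys a y \<le> dynamic_mdl C w xs ys a y"
    and "0 < \<mu> a y \<Longrightarrow> 0 < dynamic_mdl C w xs ys a y"
  using value_pos[OF assms] value_nonneg[of "xs @ [a]" "ys @ [y]"] value_snoc_le[of xs ys a y]
    value_snoc_ge[of xs ys a y] value_pos[of "xs @ [a]" "ys @ [y]"] assms
  by (auto simp: dynamic_mdl_def field_simps)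

lemma excess_mass_nonneg:
  assumes "length xs = length ys" "0 < M xs ys"
  shows "0 \<le> excess_mass xs ys a"
  using value_le_sum_snoc[OF assms(1), of a] value_pos[OF assms]
  by (simp add: excess_mass_def dynamic_mdl_def flip: sum_divide_distrib)

lemma quadratic_dynamic_le:
  assumes "length xs = length ys" "0 < M xs ys"
  shows "quadratic_distance (\<mu> a) (dynamic_mdl C w xs ys a)
    \<le> 4 * hellinger_distance (\<mu> a) (dynamic_mdl C w xs ys a)"
  by (intro quadratic_distance_le_hellinger_distance model_nonneg[OF true_model]
      model_le_1[OF true_model] dynamic_bounds assms)

text \<open>The static prediction lies below the dynamic one and has mass 1, so the pointwise gaps
  add up to \<open>excess_mass\<close>; each summand of either distance is at most its gap.\<close>

lemma static_vs_dynamic: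
  assumes "length xs = length ys" "0 < M xs ys"
  shows "hellinger_distance (dynamic_mdl C w xs ys a) (static_mdl \<nu>_star xs ys a)
      \<le> excess_mass xs ys a" (is ?H)
    and "quadratic_distance (dynamic_mdl C w xs ys a) (static_mdl \<nu>_star xs ys a)
      \<le> excess_mass xs ys a" (is ?Q)
proof -
  let ?q = "dynamic_mdl C w xs ys a" and ?s = "static_mdl \<nu>_star xs ys a"
  have s: "0 \<le> ?s y" "?s y \<le> ?q y" for y
    using dynamic_bounds(3)[OF assms] model_nonneg[OF star_in[OF assms(1)]]
    by (auto simp: static_mdl_def)
  have mass: "(\<Sum>y\<in>UNIV. ?q y - ?s y) = excess_mass xs ys a"
    using model_sum[OF star_in[OF assms(1)], of a]
    by (simp add: sum_subtractf excess_mass_def static_mdl_def)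
  show ?H
    unfolding hellinger_distance_def mass[symmetric]
    by (intro sum_mono sqrt_diff_squared_le s)
  \<comment> \<open>The gap lies between 0 and 1, so squaring does not increase it.\<close>
  have "(?q y - ?s y)\<^sup>2 \<le> ?q y - ?s y" for y
    unfolding power2_eq_square
    using s[of y] dynamic_bounds(2)[OF assms, of a y] by (intro mult_right_le_one_le) auto
  then show ?Q
    unfolding quadratic_distance_def mass[symmetric] by (intro sum_mono)
qed

text \<open>Cancelling \<open>V xs ys\<close> gives the form treated by
  \<open>hellinger_distance_normalize_le\<close>.\<close>

lemma normalized_eq:
  assumes "length xs = length ys" "0 < M xs ys"
  shows "normalized_dynamic_mdl C w xs ys a =
    (\<lambda>y. dynamic_mdl C w xs ys a y / (\<Sum>y\<in>UNIV. dynamic_mdl C w xs ys a y))"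
  using value_pos[OF assms]
  by (auto simp: normalized_dynamic_mdl_def dynamic_mdl_def simp flip: sum_divide_distrib)

lemma hellinger_normalized_le:
  assumes "length xs = length ys" "0 < M xs ys"
  shows "hellinger_distance (\<mu> a) (normalized_dynamic_mdl C w xs ys a)
    \<le> hellinger_distance (\<mu> a) (dynamic_mdl C w xs ys a)"
  unfolding normalized_eq[OF assms]
  using excess_mass_nonneg[OF assms, of a] dynamic_bounds(1)[OF assms]
  by (intro hellinger_distance_normalize_le model_nonneg[OF true_model] model_sum[OF true_model])
     (auto simp: excess_mass_def)

lemma quadratic_normalized_le:
  assumes "length xs = length ys" "0 < M xs ys"
  shows "quadratic_distance (\<mu> a) (normalized_dynamic_mdl C w xs ys a)
    \<le> 4 * hellinger_distance (\<mu> a) (normalized_dynamic_mdl C w xs ys a)"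
proof (intro quadratic_distance_le_hellinger_distance model_nonneg[OF true_model]
    model_le_1[OF true_model])
  let ?q = "dynamic_mdl C w xs ys a"
  have mass: "1 \<le> (\<Sum>y\<in>UNIV. ?q y)"
    using excess_mass_nonneg[OF assms, of a] by (simp add: excess_mass_def)
  fix y
  have "?q y \<le> (\<Sum>y\<in>UNIV. ?q y)"
    using dynamic_bounds(1)[OF assms] by (intro member_le_sum) auto
  then show "0 \<le> normalized_dynamic_mdl C w xs ys a y"
    "normalized_dynamic_mdl C w xs ys a y \<le> 1"
    unfolding normalized_eq[OF assms] using mass dynamic_bounds(1)[OF assms, of a y] by auto
qed

lemma distance_le_loss_bound:
  assumes "length xs = length ys" "0 < M xs ys"
    and "P \<in> {static_mdl \<nu>_star, dynamic_mdl C w, normalized_dynamic_mdl C w}"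
    and "D \<in> {hellinger_distance, quadratic_distance}"
  shows "D (\<mu> a) (P xs ys a) \<le> loss_bound xs ys a"
proof -
  let ?h = "hellinger_distance (\<mu> a) (dynamic_mdl C w xs ys a)"
  note nonneg = excess_mass_nonneg[OF assms(1,2), of a]
    hellinger_distance_nonneg[of "\<mu> a" "dynamic_mdl C w xs ys a"]
  have static: "hellinger_distance (\<mu> a) (static_mdl \<nu>_star xs ys a) \<le> loss_bound xs ys a"
    "quadratic_distance (\<mu> a) (static_mdl \<nu>_star xs ys a) \<le> loss_bound xs ys a"
    using nonneg static_vs_dynamic[OF assms(1,2), of a] quadratic_dynamic_le[OF assms(1,2), of a]
      hellinger_distance_triangle[of "\<mu> a" "static_mdl \<nu>_star xs ys a" "dynamic_mdl C w xs ys a"]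
      quadratic_distance_triangle[of "\<mu> a" "static_mdl \<nu>_star xs ys a" "dynamic_mdl C w xs ys a"]
    unfolding loss_bound_def by linarith+
  have dynamic: "?h \<le> loss_bound xs ys a"
    "quadratic_distance (\<mu> a) (dynamic_mdl C w xs ys a) \<le> loss_bound xs ys a"
    using nonneg quadratic_dynamic_le[OF assms(1,2), of a] unfolding loss_bound_def by linarith+
  have normalized:
    "hellinger_distance (\<mu> a) (normalized_dynamic_mdl C w xs ys a) \<le> loss_bound xs ys a"
    "quadratic_distance (\<mu> a) (normalized_dynamic_mdl C w xs ys a) \<le> loss_bound xs ys a"
    using nonneg hellinger_normalized_le[OF assms(1,2), of a]
      quadratic_normalized_le[OF assms(1,2), of a]
    unfolding loss_bound_def by linarith+
  show ?thesis using assms(3,4) static dynamic normalized by blast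
qed

section \<open>The potential and its growth\<close>

text \<open>Summed over histories of one length, this is the Kullback-Leibler sum of
  \<open>\<mu>\<close> against the maximal weighted likelihood. Histories with
  \<open>M xs ys = 0\<close> contribute 0.\<close>

definition log_regret :: "'x list \<Rightarrow> 'y list \<Rightarrow> real" where
  "log_regret xs ys = M xs ys * ln (M xs ys / V xs ys)"

text \<open>The 8 is that of \<open>loss_bound\<close>. Each Hellinger term costs one excess mass
  besides the logarithm, so 8 + 2 = 10 excess masses are paid from the growth of
  \<open>V\<close>.\<close>

definition potential :: "'x list \<Rightarrow> 'y list \<Rightarrow> real" where
  "potential xs ys = 8 * log_regret xs ys + 10 * inverse (w \<mu>) * V xs ys"

lemma likelihood_le_value:
  assumes "length xs = length ys"
  shows "M xs ys \<le> inverse (w \<mu>) * V xs ys"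
  using value_ge[OF assms true_model] weight_pos[OF true_model]
  by (simp add: field_simps)

text \<open>Multiplied by \<open>V xs ys\<close>, the excess mass is exactly the growth of
  \<open>V\<close>; \<open>likelihood_le_value\<close> lets \<open>V\<close> replace
  \<open>M\<close>.\<close>

lemma excess_mass_step:
  assumes "length xs = length ys" "0 < M xs ys"
  shows "M xs ys * excess_mass xs ys a
    \<le> inverse (w \<mu>) * ((\<Sum>y\<in>UNIV. V (xs @ [a]) (ys @ [y])) - V xs ys)"
proof -
  have V: "0 < V xs ys" using assms by (rule value_pos)
  then have eq: "V xs ys * excess_mass xs ys a = (\<Sum>y\<in>UNIV. V (xs @ [a]) (ys @ [y])) - V xs ys"
    by (simp add: excess_mass_def dynamic_mdl_def field_simps flip: sum_divide_distrib)
  have "M xs ys * excess_mass xs ys a \<le> inverse (w \<mu>) * V xs ys * excess_mass xs ys a"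
    using assms by (intro mult_right_mono likelihood_le_value excess_mass_nonneg)
  then show ?thesis by (simp add: mult.assoc eq)
qed

text \<open>Chain rule: appending \<open>y\<close> multiplies the ratio of \<open>M\<close> to
  \<open>V\<close> by \<open>\<mu> a y / dynamic_mdl C w xs ys a y\<close>. For
  \<open>\<mu> a y = 0\<close> both sides vanish.\<close>

lemma log_regret_snoc:
  assumes "length xs = length ys" "0 < M xs ys"
  shows "log_regret (xs @ [a]) (ys @ [y]) =
    M xs ys * (\<mu> a y * ln (\<mu> a y / dynamic_mdl C w xs ys a y)) +
    \<mu> a y * log_regret xs ys"
proof (cases "\<mu> a y = 0")
  case False
  then have \<mu>: "0 < \<mu> a y" using model_nonneg[OF true_model, of a y] by simp
  have V: "0 < V xs ys" "0 < V (xs @ [a]) (ys @ [y])"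
    using assms \<mu> by (auto intro!: value_pos)
  show ?thesis
    using assms \<mu> V
    by (simp add: log_regret_def dynamic_mdl_def ln_div ln_mult algebra_simps)
qed (use assms in \<open>simp add: log_regret_def\<close>)

text \<open>Summing the chain rule over \<open>y\<close>, the logarithmic part of the divergence
  becomes the growth of \<open>log_regret\<close>, while \<open>- p + q\<close> adds up to
  \<open>excess_mass\<close>.\<close>

lemma hellinger_step:
  assumes "length xs = length ys" "0 < M xs ys"
  shows "M xs ys * hellinger_distance (\<mu> a) (dynamic_mdl C w xs ys a)
    \<le> (\<Sum>y\<in>UNIV. log_regret (xs @ [a]) (ys @ [y])) - log_regret xs ys
      + M xs ys * excess_mass xs ys a"
proof -
  let ?q = "dynamic_mdl C w xs ys a"
  have "hellinger_distance (\<mu> a) ?q \<le> (\<Sum>y\<in>UNIV. \<mu> a y * ln (\<mu> a y / ?q y) - \<mu> a y + ?q y)"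
    unfolding hellinger_distance_def
    by (intro sum_mono hellinger_le_divergence model_nonneg[OF true_model] dynamic_bounds assms)
  also have "\<dots> = (\<Sum>y\<in>UNIV. \<mu> a y * ln (\<mu> a y / ?q y)) + excess_mass xs ys a"
    using model_sum[OF true_model, of a]
    by (simp add: sum.distrib sum_subtractf excess_mass_def)
  finally have "M xs ys * hellinger_distance (\<mu> a) ?q
    \<le> M xs ys * ((\<Sum>y\<in>UNIV. \<mu> a y * ln (\<mu> a y / ?q y)) + excess_mass xs ys a)"
    using assms by (intro mult_left_mono) auto
  moreover have "(\<Sum>y\<in>UNIV. log_regret (xs @ [a]) (ys @ [y])) =
    M xs ys * (\<Sum>y\<in>UNIV. \<mu> a y * ln (\<mu> a y / ?q y)) + log_regret xs ys"
    using model_sum[OF true_model, of a]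
    by (simp add: log_regret_snoc[OF assms] sum.distrib flip: sum_distrib_left sum_distrib_right)
  ultimately show ?thesis by (simp add: algebra_simps)
qed

lemma loss_bound_step:
  assumes len: "length xs = length ys" and M: "0 < M xs ys"
  shows "M xs ys * loss_bound xs ys a
    \<le> (\<Sum>y\<in>UNIV. potential (xs @ [a]) (ys @ [y])) - potential xs ys"
proof -
  let ?m = "M xs ys * excess_mass xs ys a"
  have linear: "8 * h + 2 * m \<le> 8 * L + 10 * R" if "h \<le> L + m" "m \<le> R" for h m L R :: real
    using that by linarith
  have "M xs ys * loss_bound xs ys a =
    8 * (M xs ys * hellinger_distance (\<mu> a) (dynamic_mdl C w xs ys a)) + 2 * ?m"
    by (simp add: loss_bound_def algebra_simps)
  also have "\<dots> \<le> 8 * ((\<Sum>y\<in>UNIV. log_regret (xs @ [a]) (ys @ [y])) - log_regret xs ys)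
      + 10 * (inverse (w \<mu>) * ((\<Sum>y\<in>UNIV. V (xs @ [a]) (ys @ [y])) - V xs ys))"
    using linear[OF hellinger_step[OF assms, of a] excess_mass_step[OF assms, of a]] .
  also have "\<dots> = (\<Sum>y\<in>UNIV. potential (xs @ [a]) (ys @ [y])) - potential xs ys"
    by (simp add: potential_def sum.distrib algebra_simps flip: sum_distrib_left)
  finally show ?thesis .
qed

text \<open>Histories of \<open>\<mu>\<close>-probability zero contribute no loss, but the predictors may take
  junk values on them, so they are treated separately.\<close>

lemma distance_step:
  assumes len: "length xs = length ys"
    and P: "P \<in> {static_mdl \<nu>_star, dynamic_mdl C w, normalized_dynamic_mdl C w}"
    and D: "D \<in> {hellinger_distance, quadratic_distance}"
  shows "M xs ys * D (\<mu> a) (P xs ys a)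
    \<le> (\<Sum>y\<in>UNIV. potential (xs @ [a]) (ys @ [y])) - potential xs ys"
proof (cases "M xs ys = 0")
  case True
  \<comment> \<open>Only the \<open>V\<close> part of the potential is left:
    \<open>log_regret\<close> vanishes here and on all extensions, whose likelihood is 0
    too.\<close>
  have "0 \<le> 10 * inverse (w \<mu>) * ((\<Sum>y\<in>UNIV. V (xs @ [a]) (ys @ [y])) - V xs ys)"
    using value_le_sum_snoc[OF len, of a] weight_pos[OF true_model] by simp
  then show ?thesis
    using True len
    by (simp add: potential_def log_regret_def algebra_simps flip: sum_distrib_left)
next
  case False
  then have M: "0 < M xs ys"
    using likelihood_nonneg[OF true_model, of xs ys] by simp
  have "M xs ys * D (\<mu> a) (P xs ys a) \<le> M xs ys * loss_bound xs ys a"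
    using M distance_le_loss_bound[OF len M P D] by (intro mult_left_mono) auto
  also note loss_bound_step[OF len M]
  finally show ?thesis .
qed

lemma log_regret_le:
  assumes "length xs = length ys"
  shows "log_regret xs ys \<le> M xs ys * ln (inverse (w \<mu>))"
proof (cases "M xs ys = 0")
  case False
  then have M: "0 < M xs ys"
    using likelihood_nonneg[OF true_model, of xs ys] by simp
  have V: "0 < V xs ys" using assms M by (rule value_pos)
  have "ln (M xs ys / V xs ys) \<le> ln (inverse (w \<mu>))"
    using likelihood_le_value[OF assms] M V weight_pos[OF true_model]
    by (subst ln_le_cancel_iff) (auto simp: field_simps)
  then show ?thesis using M by (simp add: log_regret_def)
qed (simp add: log_regret_def)

text \<open>The likelihoods under \<open>\<mu>\<close> add up to 1, the values to at most 1, and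
  \<open>ln ?W \<le> ?W\<close>; this gives 8 + 10 = 18.\<close>

lemma sum_potential_le:
  "(\<Sum>ys | length ys = n. potential (map x [0..<n]) ys) \<le> 18 * inverse (w \<mu>)"
proof -
  let ?W = "inverse (w \<mu>)" and ?xs = "map x [0..<n]"
  have W: "0 < ?W" using weight_pos[OF true_model] by simp
  have "(\<Sum>ys | length ys = n. potential ?xs ys)
    \<le> (\<Sum>ys | length ys = n. 8 * ln ?W * M ?xs ys + 10 * ?W * V ?xs ys)"
    using log_regret_le[of ?xs] by (intro sum_mono) (auto simp: potential_def mult.commute)
  also have "\<dots> = 8 * ln ?W + 10 * ?W * (\<Sum>ys | length ys = n. V ?xs ys)"
    using sum_likelihood[OF models[OF true_model], of x n]
    by (simp only: sum.distrib flip: sum_distrib_left)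
  also have "\<dots> \<le> 8 * ?W + 10 * ?W * 1"
    using W ln_le_minus_one[OF W] sum_value_le_1[of x n]
    by (intro add_mono mult_left_mono) auto
  finally show ?thesis by simp
qed

text \<open>It allows the starting value of the telescoped sum to be dropped. The empty history has
  likelihood 1 and value at most 1, so its logarithm is nonnegative.\<close>

lemma potential_Nil_nonneg: "0 \<le> potential [] []"
proof -
  have V: "0 < V [] []" by (rule value_pos) auto
  \<comment> \<open>For \<open>n = 0\<close> no input is read, so \<open>undefined\<close> is
    harmless.\<close>
  have "V [] [] \<le> 1" using sum_value_le_1[of undefined 0] by simp
  then have "0 \<le> ln (1 / V [] [])" using V by (intro ln_ge_zero) auto
  then show ?thesis
    using V weight_pos[OF true_model] by (simp add: potential_def log_regret_def)
qed

theorem cumulative_expected_le: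
  assumes "P \<in> {static_mdl \<nu>_star, dynamic_mdl C w, normalized_dynamic_mdl C w}"
    and "D \<in> {hellinger_distance, quadratic_distance}"
  shows "cumulative_expected D \<mu> P x \<le> ennreal (18 * inverse (w \<mu>))"
proof (rule cumulative_expected_le_potential[where \<Psi> = "\<lambda>t. potential (map x [0..<t])"])
  show "classification_model \<mu>" using true_model by (rule models)
  show "0 \<le> D p q" for p q
    using assms(2) hellinger_distance_nonneg quadratic_distance_nonneg by auto
  show "M (map x [0..<t]) ys * D (\<mu> (x t)) (P (map x [0..<t]) ys (x t))
    \<le> (\<Sum>y\<in>UNIV. potential (map x [0..<Suc t]) (ys @ [y])) - potential (map x [0..<t]) ys"
    if "length ys = t" for t ys
    using distance_step[OF _ assms, of "map x [0..<t]" ys "x t"] that by simp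
  show "(\<Sum>ys | length ys = n. potential (map x [0..<n]) ys) - potential (map x [0..<0]) []
    \<le> 18 * inverse (w \<mu>)" for n
    using sum_potential_le[of x n] potential_Nil_nonneg by simp
qed

end

theorem theorem6:
  fixes \<nu> :: "nat \<Rightarrow> ('x, 'y::finite) model"
    and C :: "('x, 'y) model set"
    and w :: "('x, 'y) model \<Rightarrow> real"
    and \<mu> :: "('x, 'y) model"
    and \<nu>_star :: "'x list \<Rightarrow> 'y list \<Rightarrow> ('x, 'y) model"
    and x :: "nat \<Rightarrow> 'x"
  assumes "C = {\<nu> i | i. 1 \<le> i}"
    and "\<forall>\<kappa>\<in>C. classification_model \<kappa>"
    and "\<forall>\<kappa>\<in>C. 0 < w \<kappa>"
    and "(w has_sum 1) C"
    and "\<mu> \<in> C"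
    and "mdl_estimator C w \<nu>_star"
  shows "\<forall>P \<in> {static_mdl \<nu>_star, dynamic_mdl C w, normalized_dynamic_mdl C w}.
           cumulative_expected hellinger_distance \<mu> P x \<le> ennreal (21 * inverse (w \<mu>)) \<and>
           cumulative_expected quadratic_distance \<mu> P x \<le> ennreal (21 * inverse (w \<mu>)) \<and>
           converges_almost_surely \<mu> P x"
proof
  interpret mdl_prediction C w \<mu> \<nu>_star
    using assms(2-6) by unfold_locales auto
  fix P assume P: "P \<in> {static_mdl \<nu>_star, dynamic_mdl C w, normalized_dynamic_mdl C w}"
  \<comment> \<open>The potential yields the constant 18, here weakened to 21.\<close>
  have "ennreal (18 * inverse (w \<mu>)) \<le> ennreal (21 * inverse (w \<mu>))"
    using weight_pos[OF true_model] by (intro ennreal_leI) simp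
  then have bound: "cumulative_expected D \<mu> P x \<le> ennreal (21 * inverse (w \<mu>))"
    if "D \<in> {hellinger_distance, quadratic_distance}" for D
    using cumulative_expected_le[OF P that] by (rule order_trans[rotated])
  have "cumulative_expected quadratic_distance \<mu> P x < \<infinity>"
    using bound[of quadratic_distance] by (auto simp: less_top[symmetric] top_unique)
  then have "converges_almost_surely \<mu> P x"
    using models[OF true_model] by (intro converges_almost_surely_if_quadratic_finite)
  with bound show "cumulative_expected hellinger_distance \<mu> P x \<le> ennreal (21 * inverse (w \<mu>)) \<and>
    cumulative_expected quadratic_distance \<mu> P x \<le> ennreal (21 * inverse (w \<mu>)) \<and>
    converges_almost_surely \<mu> P x" by blast
qed

end
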